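(* Each of the sets $S_n(1234, 3214)$, $S_n(4321, 4123)$, $S_n(4321, 2341)$, $S_n(1234, 1432)$, $S_n(1243, 2143)$, $S_n(3421, 3412)$, $S_n(4312, 3412)$, $S_n(2134, 2143)$, $S_n(1423, 1432)$, $S_n(3241, 2341)$, $S_n(4132, 4123)$ and $S_n(2314, 3214)$ is sign-balanced for every integer $n>1$.
   Context: Permutations are written in one-line notation $\pi=\pi_1\pi_2\cdots\pi_n\in S_n$. For $\sigma\in S_k$ and $\pi\in S_n$ with $k\le n$, $\pi$ contains the pattern $\sigma$ if there are indices $1\le i_1<\cdots<i_k\le n$ such that for all $1\le s<t\le k$, $\pi_{i_s}>\pi_{i_t}$ iff $\sigma_s>\sigma_t$; otherwise $\pi$ avoids $\sigma$. $S_n(\sigma_1,\ldots,\sigma_r)$ denotes the set of permutations in $S_n$ avoiding every $\sigma_j$. An inversion of $\pi$ is a pair $i<j$ with $\pi_i>\pi_j$; $\pi$ is even (odd) if its number of inversions is even (odd). A set of permutations is sign-balanced if it contains the same number of even permutations as odd permutations. *)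

theory Defs
  imports "HOL-Combinatorics.Multiset_Permutations"
begin

text \<open>
  Permutations are represented by their one-line notation: the elements of \<open>S\<^sub>n\<close> are the
  lists in \<^term>\<open>permutations_of_set {1..n}\<close>.  List positions are counted from 0, so
  \<open>\<pi>\<^sub>i\<close> is \<^term>\<open>\<pi> ! (i - 1)\<close>.
\<close>

definition contains_pattern :: "nat list \<Rightarrow> nat list \<Rightarrow> bool" where
  "contains_pattern \<pi> \<sigma> \<longleftrightarrow>
     (\<exists>i :: nat \<Rightarrow> nat.
        strict_mono_on {..<length \<sigma>} i \<and>
        (\<forall>s < length \<sigma>. i s < length \<pi>) \<and>
        (\<forall>s t. s < t \<and> t < length \<sigma> \<longrightarrow> (\<pi> ! i s > \<pi> ! i t \<longleftrightarrow> \<sigma> ! s > \<sigma> ! t)))"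

definition avoiders :: "nat \<Rightarrow> nat list set \<Rightarrow> nat list set" where
  "avoiders n \<Sigma> = {\<pi> \<in> permutations_of_set {1..n}. \<forall>\<sigma>\<in>\<Sigma>. \<not> contains_pattern \<pi> \<sigma>}"

definition inversions :: "nat list \<Rightarrow> (nat \<times> nat) set" where
  "inversions \<pi> = {(i, j). i < j \<and> j < length \<pi> \<and> \<pi> ! i > \<pi> ! j}"

definition even_perm :: "nat list \<Rightarrow> bool" where
  "even_perm \<pi> \<longleftrightarrow> even (card (inversions \<pi>))"

definition odd_perm :: "nat list \<Rightarrow> bool" where
  "odd_perm \<pi> \<longleftrightarrow> odd (card (inversions \<pi>))"

text \<open>Meaningful for finite sets only; every \<^term>\<open>avoiders n \<Sigma>\<close> is finite.\<close>

definition sign_balanced :: "nat list set \<Rightarrow> bool" where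
  "sign_balanced A \<longleftrightarrow> card {\<pi> \<in> A. even_perm \<pi>} = card {\<pi> \<in> A. odd_perm \<pi>}"

end

theory Submission
  imports Defs
begin

text \<open>
  Swapping two adjacent entries of a permutation changes its sign, so every set is balanced by an
  involution built from adjacent swaps.  In eight of the twelve cases the two patterns differ by a
  swap of their first two (or last two) entries, and swapping the first (last) two entries of the
  permutation preserves the set.

  The remaining four cases are related by reversal and complementation, which change all signs by a
  common factor; it suffices to treat the pair 1234, 3214, by induction on \<open>n\<close>.  Deleting a leading
  entry \<open>n\<close> leaves an arbitrary avoider of length \<open>n - 1\<close>.  If \<open>n\<close> comes later, the entries before it
  contain no monotone triple, so there are at most four of them.  The involution swaps the second and
  third entries, unless \<open>n\<close> is the fourth entry and the third is the median of the first three, in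
  which case it swaps the first two.
\<close>

section \<open>Adjacent swaps and the sign\<close>

definition swap_adj :: "nat \<Rightarrow> 'a list \<Rightarrow> 'a list" where
  "swap_adj p xs = xs[p := xs ! Suc p, Suc p := xs ! p]"

lemma length_swap_adj [simp]: "length (swap_adj p xs) = length xs"
  by (simp add: swap_adj_def)

lemma nth_swap_adj:
  "Suc p < length xs \<Longrightarrow> i < length xs \<Longrightarrow> swap_adj p xs ! i = xs ! transpose p (Suc p) i"
  by (auto simp: swap_adj_def nth_list_update transpose_def)

lemma swap_adj_swap_adj [simp]: "Suc p < length xs \<Longrightarrow> swap_adj p (swap_adj p xs) = xs"
  by (rule nth_equalityI) (auto simp: swap_adj_def nth_list_update)

lemma distinct_swap_adj [simp]: "Suc p < length xs \<Longrightarrow> distinct (swap_adj p xs) = distinct xs"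
  by (simp add: swap_adj_def distinct_swap)

lemma set_swap_adj [simp]: "Suc p < length xs \<Longrightarrow> set (swap_adj p xs) = set xs"
  by (simp add: swap_adj_def set_swap)

lemma finite_inversions [simp]: "finite (inversions \<pi>)"
  by (rule finite_subset[of _ "{..<length \<pi>} \<times> {..<length \<pi>}"]) (auto simp: inversions_def)

text \<open>Moving positions by the transposition carries the inversions of \<open>\<pi>\<close> to
  inversions of the swapped list; the pair \<open>(p, Suc p)\<close> is the only new one.\<close>

lemma card_inversions_swap_adj_less:
  assumes p: "Suc p < length \<pi>" and less: "\<pi> ! p < \<pi> ! Suc p"
  shows "card (inversions (swap_adj p \<pi>)) = Suc (card (inversions \<pi>))"
proof -
  let ?t = "transpose p (Suc p)"
  have t: "?t (?t i) = i" for i by simp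
  have tlen: "?t i < length \<pi> \<longleftrightarrow> i < length \<pi>" for i
    using p by (auto simp: transpose_def)
  \<comment> \<open>An adjacent transposition reverses the order of no pair of positions other than
    the swapped one.\<close>
  have mono: "?t i < ?t j" if "i < j" "(i, j) \<noteq> (p, Suc p)" for i j
    using that by (auto simp: transpose_def)
  have "inversions (swap_adj p \<pi>) = insert (p, Suc p) (map_prod ?t ?t ` inversions \<pi>)"
    (is "?L = ?R")
  proof (intro equalityI subsetI)
    fix x assume "x \<in> ?L"
    then obtain i j where x: "x = (i, j)" "i < j" "j < length \<pi>" "\<pi> ! ?t i > \<pi> ! ?t j"
      using p by (auto simp: inversions_def nth_swap_adj)
    show "x \<in> ?R"
    proof (cases "(i, j) = (p, Suc p)")
      case False
      then have "(?t i, ?t j) \<in> inversions \<pi>"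
        using x mono tlen by (auto simp: inversions_def)
      then have "map_prod ?t ?t (?t i, ?t j) \<in> map_prod ?t ?t ` inversions \<pi>" by (rule imageI)
      then show ?thesis using x by simp
    qed (use x in simp)
  next
    fix x assume "x \<in> ?R"
    then consider "x = (p, Suc p)" | i j where "(i, j) \<in> inversions \<pi>" "x = (?t i, ?t j)" by auto
    then show "x \<in> ?L"
    proof cases
      case 2
      then have "(i, j) \<noteq> (p, Suc p)" using less by (auto simp: inversions_def)
      then show ?thesis using 2 p mono tlen by (auto simp: inversions_def nth_swap_adj)
    qed (use p less in \<open>auto simp: inversions_def nth_swap_adj\<close>)
  qed
  \<comment> \<open>Its preimage would be \<open>(Suc p, p)\<close>, whose components are not
    increasing.\<close>
  moreover have "(p, Suc p) \<notin> map_prod ?t ?t ` inversions \<pi>"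
  proof
    assume "(p, Suc p) \<in> map_prod ?t ?t ` inversions \<pi>"
    then obtain i j where ij: "i < j" "p = ?t i" "Suc p = ?t j" by (auto simp: inversions_def)
    from ij(2,3) have "i = Suc p" "j = p"
      by (metis t transpose_apply_first, metis t transpose_apply_second)
    with \<open>i < j\<close> show False by simp
  qed
  moreover have "inj_on (map_prod ?t ?t) (inversions \<pi>)"
    by (rule inj_on_inverseI[of _ "map_prod ?t ?t"]) auto
  ultimately show ?thesis by (simp add: card_image)
qed

lemma even_perm_swap_adj:
  assumes "Suc p < length \<pi>" "distinct \<pi>"
  shows "even_perm (swap_adj p \<pi>) \<longleftrightarrow> \<not> even_perm \<pi>"
proof (cases "\<pi> ! p < \<pi> ! Suc p")
  case True
  then show ?thesis using card_inversions_swap_adj_less[OF assms(1)] by (simp add: even_perm_def)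
next
  case False
  moreover have "\<pi> ! p \<noteq> \<pi> ! Suc p" using assms by (simp add: nth_eq_iff_index_eq)
  \<comment> \<open>In the descending case the swapped list ascends at \<open>p\<close>, and
    swapping it again returns \<open>\<pi>\<close>, so the count is applied in the other
    direction.\<close>
  ultimately have "swap_adj p \<pi> ! p < swap_adj p \<pi> ! Suc p"
    using assms by (simp add: nth_swap_adj)
  from card_inversions_swap_adj_less[OF _ this] show ?thesis
    using assms by (simp add: even_perm_def)
qed

section \<open>Criteria for sign balance\<close>

lemma sign_balanced_involution:
  assumes "\<And>\<pi>. \<pi> \<in> A \<Longrightarrow> f \<pi> \<in> A" "\<And>\<pi>. \<pi> \<in> A \<Longrightarrow> f (f \<pi>) = \<pi>"
    and "\<And>\<pi>. \<pi> \<in> A \<Longrightarrow> even_perm (f \<pi>) \<longleftrightarrow> \<not> even_perm \<pi>"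
  shows "sign_balanced A"
proof -
  have "bij_betw f {\<pi> \<in> A. even_perm \<pi>} {\<pi> \<in> A. odd_perm \<pi>}"
    using assms by (intro bij_betw_byWitness[where f' = f]) (auto simp: odd_perm_def even_perm_def)
  then show ?thesis unfolding sign_balanced_def by (rule bij_betw_same_card)
qed

lemma sign_balanced_Un:
  assumes "finite A" "finite B" "A \<inter> B = {}" "sign_balanced A" "sign_balanced B"
  shows "sign_balanced (A \<union> B)"
proof -
  have *: "card {\<pi> \<in> A \<union> B. P \<pi>} = card {\<pi> \<in> A. P \<pi>} + card {\<pi> \<in> B. P \<pi>}" for P
    using assms(1-3) by (subst card_Un_disjoint[symmetric]) (auto intro: arg_cong[where f = card])
  show ?thesis using assms(4,5) unfolding sign_balanced_def * by simp
qed

text \<open>The flag \<open>e\<close> records whether \<open>g\<close> keeps all signs or flips all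
  of them; in both cases even and odd members stay together as classes. This serves reversal,
  complementation and prepending a maximum, whose effect on the sign depends only on the
  length.\<close>

lemma sign_balanced_image:
  assumes "sign_balanced A" "inj_on g A"
    and sgn: "\<And>\<pi>. \<pi> \<in> A \<Longrightarrow> even_perm (g \<pi>) \<longleftrightarrow> (even_perm \<pi> \<longleftrightarrow> e)"
  shows "sign_balanced (g ` A)"
proof -
  have odd: "odd_perm \<pi> \<longleftrightarrow> \<not> even_perm \<pi>" for \<pi> by (simp add: odd_perm_def even_perm_def)
  have card: "card {\<pi> \<in> g ` A. P \<pi>} = card {\<pi> \<in> A. P (g \<pi>)}" for P
  proof -
    have "{\<pi> \<in> g ` A. P \<pi>} = g ` {\<pi> \<in> A. P (g \<pi>)}" by auto
    then show ?thesis using assms(2) by (simp add: card_image inj_on_def)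
  qed
  have "card {\<pi> \<in> A. even_perm (g \<pi>)} = card {\<pi> \<in> A. if e then even_perm \<pi> else odd_perm \<pi>}"
    "card {\<pi> \<in> A. odd_perm (g \<pi>)} = card {\<pi> \<in> A. if e then odd_perm \<pi> else even_perm \<pi>}"
    by (auto simp: odd sgn intro!: arg_cong[where f = card])
  then show ?thesis using assms(1) unfolding sign_balanced_def card by (cases e) auto
qed

section \<open>Avoidance under adjacent swaps\<close>

lemma avoidersD:
  assumes "\<pi> \<in> avoiders n \<Sigma>"
  shows "distinct \<pi>" "set \<pi> = {1..n}" "length \<pi> = n"
proof -
  show *: "distinct \<pi>" "set \<pi> = {1..n}"
    using assms by (auto simp: avoiders_def dest: permutations_of_setD)
  show "length \<pi> = n" using distinct_card[OF *(1)] *(2) by simp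
qed

lemma finite_avoiders [simp]: "finite (avoiders n \<Sigma>)"
  by (rule finite_subset[of _ "permutations_of_set {1..n}"]) (auto simp: avoiders_def)

lemma avoidersI:
  "distinct \<pi> \<Longrightarrow> set \<pi> = {1..n} \<Longrightarrow> (\<And>\<sigma>. \<sigma> \<in> \<Sigma> \<Longrightarrow> \<not> contains_pattern \<pi> \<sigma>) \<Longrightarrow> \<pi> \<in> avoiders n \<Sigma>"
  by (auto simp: avoiders_def intro: permutations_of_setI)

lemma avoiders_not_contains: "\<pi> \<in> avoiders n \<Sigma> \<Longrightarrow> \<sigma> \<in> \<Sigma> \<Longrightarrow> \<not> contains_pattern \<pi> \<sigma>"
  by (simp add: avoiders_def)

text \<open>If the two swapped positions do not both take part in an occurrence, the occurrence moves
  along with the swap; if they do, they are adjacent in it, so the swap acts on the pattern.\<close>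

lemma contains_swap_adj:
  assumes p: "Suc p < length \<pi>" and dist: "distinct \<pi>" "distinct \<sigma>"
    and cont: "contains_pattern (swap_adj p \<pi>) \<sigma>"
  obtains "contains_pattern \<pi> \<sigma>"
  | s where "Suc s < length \<sigma>" "contains_pattern \<pi> (swap_adj s \<sigma>)" "s \<le> p"
      "length \<sigma> + p \<le> length \<pi> + s"
proof -
  let ?t = "transpose p (Suc p)" and ?m = "length \<sigma>"
  obtain i where mono: "strict_mono_on {..<?m} i" and len: "\<And>s. s < ?m \<Longrightarrow> i s < length \<pi>"
    and ord: "\<And>s t. s < t \<Longrightarrow> t < ?m \<Longrightarrow> \<pi> ! ?t (i s) > \<pi> ! ?t (i t) \<longleftrightarrow> \<sigma> ! s > \<sigma> ! t"
  proof -
    from cont obtain i where i: "strict_mono_on {..<?m} i" "\<And>s. s < ?m \<Longrightarrow> i s < length \<pi>"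
      "\<And>s t. s < t \<Longrightarrow> t < ?m \<Longrightarrow> swap_adj p \<pi> ! i s > swap_adj p \<pi> ! i t \<longleftrightarrow> \<sigma> ! s > \<sigma> ! t"
      unfolding contains_pattern_def by auto
    show ?thesis
    proof (rule that[OF i(1,2)])
      fix s t assume "s < t" "t < ?m"
      then show "\<pi> ! ?t (i s) > \<pi> ! ?t (i t) \<longleftrightarrow> \<sigma> ! s > \<sigma> ! t"
        using i(2)[of s] i(2)[of t] i(3)[of s t] p by (simp add: nth_swap_adj)
    qed
  qed
  have less: "i s < i t" if "s < t" "t < ?m" for s t
    using mono that by (auto simp: strict_mono_on_def)
  show thesis
  proof (cases "\<exists>s t. s < t \<and> t < ?m \<and> i s = p \<and> i t = Suc p")
    case False
    \<comment> \<open>Only an occurrence using both swapped positions could lose its order when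
      moved by the transposition.\<close>
    have "strict_mono_on {..<?m} (?t \<circ> i)"
    proof (rule strict_mono_onI)
      fix r s assume rs: "r \<in> {..<?m}" "s \<in> {..<?m}" "r < s"
      then have "i r < i s" "\<not> (i r = p \<and> i s = Suc p)" using less False by auto
      then show "(?t \<circ> i) r < (?t \<circ> i) s" by (auto simp: transpose_def)
    qed
    moreover have "(?t \<circ> i) s < length \<pi>" if "s < ?m" for s
      using len[OF that] p by (auto simp: transpose_def)
    ultimately have "contains_pattern \<pi> \<sigma>"
      using ord unfolding contains_pattern_def by (intro exI[of _ "?t \<circ> i"]) auto
    then show thesis by (rule that(1))
  next
    case True
    then obtain s t where st: "s < t" "t < ?m" "i s = p" "i t = Suc p" by blast
    have "t = Suc s"
    proof (rule ccontr)
      assume "t \<noteq> Suc s"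
      then have "i s < i (Suc s)" "i (Suc s) < i t" using less[of s "Suc s"] less[of "Suc s" t] st by auto
      then show False using st by simp
    qed
    note st = st[unfolded this]
    \<comment> \<open>On the positions of the occurrence, swapping in \<open>\<pi>\<close> amounts
      to swapping indices \<open>s\<close> and \<open>Suc s\<close> of the pattern. The same
      positions \<open>i\<close> therefore witness the swapped pattern.\<close>
    have ti: "?t (i r) = i (transpose s (Suc s) r)" if "r < ?m" for r
    proof (cases "r = s \<or> r = Suc s")
      case True then show ?thesis using st by auto
    next
      case False
      then have "i r \<noteq> p" "i r \<noteq> Suc p"
        using st that less by (metis linorder_neqE_nat nat_neq_iff Suc_lessD)+
      then show ?thesis using False by (simp add: transpose_def)
    qed
    have "contains_pattern \<pi> (swap_adj s \<sigma>)"
      unfolding contains_pattern_def length_swap_adj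
    proof (intro exI conjI allI impI)
      fix u v assume uv: "u < v \<and> v < ?m"
      let ?r = "transpose s (Suc s)"
      have lt: "?r u < ?m" "?r v < ?m" using uv st by (auto simp: transpose_def)
      have idx: "i u = ?t (i (?r u))" "i v = ?t (i (?r v))" using ti[OF lt(1)] ti[OF lt(2)] by auto
      show "\<pi> ! i v < \<pi> ! i u \<longleftrightarrow> swap_adj s \<sigma> ! v < swap_adj s \<sigma> ! u"
      proof (cases "?r u < ?r v")
        case True
        then show ?thesis using ord[OF True lt(2)] idx uv st by (simp add: nth_swap_adj)
      next
        \<comment> \<open>Here \<open>(u, v)\<close> is \<open>(s, Suc s)\<close>, so
          \<open>ord\<close> gives the comparison in the opposite direction; distinctness of both
          lists turns it around.\<close>
        case False
        moreover have "?r u \<noteq> ?r v" using uv by (metis nat_neq_iff transpose_involutory)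
        ultimately have vu: "?r v < ?r u" by simp
        have "i u \<noteq> i v" "i u < length \<pi>" "i v < length \<pi>"
          using less[of u v] len uv by auto
        then have "\<pi> ! i u \<noteq> \<pi> ! i v" using dist by (simp add: nth_eq_iff_index_eq)
        moreover have "\<sigma> ! ?r u \<noteq> \<sigma> ! ?r v" using dist lt vu by (simp add: nth_eq_iff_index_eq)
        ultimately show ?thesis using ord[OF vu lt(1)] idx uv st
          by (simp add: nth_swap_adj) linarith
      qed
    qed (use mono len in auto)
    \<comment> \<open>The \<open>s\<close> earlier positions of the occurrence must fit before
      \<open>p\<close>; the next claim counts the positions after \<open>p\<close> in the same
      way.\<close>
    moreover have "s \<le> p"
    proof -
      have "r \<le> i r" if "r < ?m" for r
        using that
      proof (induction r)
        case (Suc r)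
        then show ?case using less[of r "Suc r"] by simp
      qed simp
      then show ?thesis using st by force
    qed
    moreover have "?m + p \<le> length \<pi> + s"
    proof -
      have "p + r \<le> i (s + r)" if "s + r < ?m" for r
        using that
      proof (induction r)
        case (Suc r)
        then show ?case using less[of "s + r" "s + Suc r"] by simp
      qed (use st in simp)
      moreover have "s + (?m - 1 - s) = ?m - 1" "?m - 1 < ?m" using st by auto
      ultimately have "p + (?m - 1 - s) \<le> i (?m - 1)" by metis
      then show ?thesis using st len[of "?m - 1"] by linarith
    qed
    ultimately show thesis using st that(2) by blast
  qed
qed

text \<open>An occurrence created by the swap comes from an occurrence of a pattern with two
  adjacent entries exchanged. The bounds on \<open>s\<close> ask for room for the pattern entries
  before \<open>s\<close> and after \<open>Suc s\<close>; they leave at most one \<open>s\<close>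
  when \<open>p\<close> is at either end of the permutation.\<close>

lemma sign_balanced_avoiders_swap:
  assumes p: "Suc p < n" and dist: "\<And>\<sigma>. \<sigma> \<in> \<Sigma> \<Longrightarrow> distinct \<sigma>"
    and closed: "\<And>\<sigma> s. \<sigma> \<in> \<Sigma> \<Longrightarrow> Suc s < length \<sigma> \<Longrightarrow> s \<le> p \<Longrightarrow> length \<sigma> + p \<le> n + s \<Longrightarrow>
      swap_adj s \<sigma> \<in> \<Sigma>"
  shows "sign_balanced (avoiders n \<Sigma>)"
proof (rule sign_balanced_involution[where f = "swap_adj p"])
  fix \<pi> assume \<pi>: "\<pi> \<in> avoiders n \<Sigma>"
  note * = avoidersD[OF \<pi>]
  show "swap_adj p \<pi> \<in> avoiders n \<Sigma>"
  proof (rule avoidersI)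
    fix \<sigma> assume "\<sigma> \<in> \<Sigma>"
    show "\<not> contains_pattern (swap_adj p \<pi>) \<sigma>"
    proof
      assume "contains_pattern (swap_adj p \<pi>) \<sigma>"
      then show False
      proof (rule contains_swap_adj[rotated 3])
        fix s assume "Suc s < length \<sigma>" "contains_pattern \<pi> (swap_adj s \<sigma>)" "s \<le> p"
          "length \<sigma> + p \<le> length \<pi> + s"
        then show False using closed[OF \<open>\<sigma> \<in> \<Sigma>\<close>] avoiders_not_contains[OF \<pi>] *(3) by auto
      qed (use p * \<pi> \<open>\<sigma> \<in> \<Sigma>\<close> dist avoiders_not_contains in auto)
    qed
  qed (use p * in auto)
qed (use p avoidersD in \<open>auto simp: even_perm_swap_adj\<close>)

section \<open>Reversal and complementation\<close>

text \<open>By distinctness each pair of positions either strictly descends or strictly ascends.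
  Reversal and complementation exchange the two kinds, so they shift the parity by an amount
  depending only on the length.\<close>

lemma coinversions_card:
  assumes "distinct \<pi>"
  shows "card (inversions \<pi>) + card {(i, j). i < j \<and> j < length \<pi> \<and> \<pi> ! i < \<pi> ! j} =
    card {(i, j). i < j \<and> j < length \<pi>}" (is "_ + card ?C = card ?P")
proof -
  have "\<pi> ! i \<noteq> \<pi> ! j" if "i < j" "j < length \<pi>" for i j
    using assms that by (simp add: nth_eq_iff_index_eq)
  then have "?P = inversions \<pi> \<union> ?C"
    unfolding inversions_def by (auto simp: linorder_neq_iff)
  moreover have "finite ?C"
    by (rule finite_subset[of _ "{..<length \<pi>} \<times> {..<length \<pi>}"]) auto
  moreover have "inversions \<pi> \<inter> ?C = {}" by (auto simp: inversions_def)
  ultimately show ?thesis by (simp add: card_Un_disjoint)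
qed

lemma inversions_map_antimono:
  assumes "\<And>x y. x \<in> set \<pi> \<Longrightarrow> y \<in> set \<pi> \<Longrightarrow> f x < f y \<longleftrightarrow> y < x"
  shows "inversions (map f \<pi>) = {(i, j). i < j \<and> j < length \<pi> \<and> \<pi> ! i < \<pi> ! j}"
  using assms by (auto simp: inversions_def)

lemma card_inversions_rev:
  "card (inversions (rev \<pi>)) = card {(i, j). i < j \<and> j < length \<pi> \<and> \<pi> ! i < \<pi> ! j}"
proof -
  let ?r = "\<lambda>i. length \<pi> - Suc i"
  have "bij_betw (\<lambda>(i, j). (?r j, ?r i)) (inversions (rev \<pi>))
      {(i, j). i < j \<and> j < length \<pi> \<and> \<pi> ! i < \<pi> ! j}"
    by (rule bij_betw_byWitness[where f' = "\<lambda>(i, j). (?r j, ?r i)"])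
      (auto simp: inversions_def rev_nth)
  then show ?thesis by (rule bij_betw_same_card)
qed

text \<open>The positions of an occurrence are mirrored. Containment compares entries only through
  \<open>>\<close>, so distinctness is used to read the comparisons backwards.\<close>

lemma contains_rev:
  assumes "contains_pattern \<pi> \<sigma>" "distinct \<pi>" "distinct \<sigma>"
  shows "contains_pattern (rev \<pi>) (rev \<sigma>)"
proof -
  obtain i where mono: "strict_mono_on {..<length \<sigma>} i"
    and len: "\<And>s. s < length \<sigma> \<Longrightarrow> i s < length \<pi>"
    and ord: "\<And>s t. s < t \<Longrightarrow> t < length \<sigma> \<Longrightarrow> \<pi> ! i s > \<pi> ! i t \<longleftrightarrow> \<sigma> ! s > \<sigma> ! t"
    using assms(1) unfolding contains_pattern_def by auto
  have less: "i s < i t" if "s < t" "t < length \<sigma>" for s t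
    using mono that by (auto simp: strict_mono_on_def)
  let ?r = "\<lambda>s. length \<sigma> - Suc s"
  let ?i = "\<lambda>s. length \<pi> - Suc (i (?r s))"
  show ?thesis
    unfolding contains_pattern_def length_rev
  proof (intro exI[of _ ?i] conjI allI impI)
    show "strict_mono_on {..<length \<sigma>} ?i"
    proof (rule strict_mono_onI)
      fix s t assume "t \<in> {..<length \<sigma>}" "s < t"
      then have "i (?r t) < i (?r s)" "i (?r s) < length \<pi>" by (auto intro: less len)
      then show "?i s < ?i t" by linarith
    qed
  next
    fix s assume "s < length \<sigma>"
    then show "?i s < length \<pi>" using len[of "?r s"] by linarith
  next
    fix s t assume "s < t \<and> t < length \<sigma>"
    then have st: "?r t < ?r s" "?r s < length \<sigma>" "s < length \<sigma>" "t < length \<sigma>" by auto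
    then have i: "i (?r t) < i (?r s)" "i (?r s) < length \<pi>" "i (?r t) < length \<pi>"
      by (auto intro: less len)
    then have "\<pi> ! i (?r t) \<noteq> \<pi> ! i (?r s)" using assms by (simp add: nth_eq_iff_index_eq)
    moreover have "\<sigma> ! ?r t \<noteq> \<sigma> ! ?r s" using assms st by (simp add: nth_eq_iff_index_eq)
    moreover have "rev \<pi> ! ?i s = \<pi> ! i (?r s)" "rev \<pi> ! ?i t = \<pi> ! i (?r t)"
      "rev \<sigma> ! s = \<sigma> ! ?r s" "rev \<sigma> ! t = \<sigma> ! ?r t"
      using st i by (simp_all add: rev_nth Suc_diff_Suc)
    ultimately show "rev \<pi> ! ?i t < rev \<pi> ! ?i s \<longleftrightarrow> rev \<sigma> ! t < rev \<sigma> ! s"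
      using ord[OF st(1,2)] by linarith
  qed
qed

text \<open>The same positions serve as a witness, since every comparison is reversed on both sides;
  distinctness again makes the comparisons strict.\<close>

lemma contains_map_antimono:
  assumes "contains_pattern \<pi> \<sigma>" "distinct \<pi>" "distinct \<sigma>"
    and f: "\<And>x y. x \<in> set \<pi> \<Longrightarrow> y \<in> set \<pi> \<Longrightarrow> f x < f y \<longleftrightarrow> y < x"
    and g: "\<And>x y. x \<in> set \<sigma> \<Longrightarrow> y \<in> set \<sigma> \<Longrightarrow> g x < g y \<longleftrightarrow> y < x"
  shows "contains_pattern (map f \<pi>) (map g \<sigma>)"
proof -
  obtain i where mono: "strict_mono_on {..<length \<sigma>} i"
    and len: "\<And>s. s < length \<sigma> \<Longrightarrow> i s < length \<pi>"
    and ord: "\<And>s t. s < t \<Longrightarrow> t < length \<sigma> \<Longrightarrow> \<pi> ! i s > \<pi> ! i t \<longleftrightarrow> \<sigma> ! s > \<sigma> ! t"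
    using assms(1) unfolding contains_pattern_def by auto
  have "map f \<pi> ! i t < map f \<pi> ! i s \<longleftrightarrow> map g \<sigma> ! t < map g \<sigma> ! s" if "s < t" "t < length \<sigma>" for s t
  proof -
    have "i s < i t" using mono that by (auto simp: strict_mono_on_def)
    then have "\<pi> ! i s \<noteq> \<pi> ! i t" using len[of s] len[of t] that assms(2) by (simp add: nth_eq_iff_index_eq)
    moreover have "\<sigma> ! s \<noteq> \<sigma> ! t" using assms(3) that by (simp add: nth_eq_iff_index_eq)
    ultimately have "\<pi> ! i s < \<pi> ! i t \<longleftrightarrow> \<sigma> ! s < \<sigma> ! t" using ord[OF that] by linarith
    then show ?thesis using that len[of s] len[of t] by (simp add: f g)
  qed
  then show ?thesis
    unfolding contains_pattern_def using mono len by (intro exI[of _ i]) auto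
qed

lemma sign_balanced_avoiders_rev:
  assumes "sign_balanced (avoiders n \<Sigma>)" and dist: "\<And>\<sigma>. \<sigma> \<in> \<Sigma> \<Longrightarrow> distinct \<sigma>"
  shows "sign_balanced (avoiders n (rev ` \<Sigma>))"
proof -
  \<comment> \<open>Stated for arbitrary \<open>S\<close>, this inclusion also applies to the
    reversed patterns; reversing once more then gives the opposite inclusion.\<close>
  have sub: "rev ` avoiders n S \<subseteq> avoiders n (rev ` S)" if "\<And>\<sigma>. \<sigma> \<in> S \<Longrightarrow> distinct \<sigma>" for S
  proof clarify
    fix \<pi> assume \<pi>: "\<pi> \<in> avoiders n S"
    show "rev \<pi> \<in> avoiders n (rev ` S)"
    proof (rule avoidersI)
      fix \<sigma> assume "\<sigma> \<in> rev ` S"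
      then obtain \<tau> where \<tau>: "\<sigma> = rev \<tau>" "\<tau> \<in> S" by blast
      then show "\<not> contains_pattern (rev \<pi>) \<sigma>"
        using contains_rev[of "rev \<pi>" \<sigma>] avoiders_not_contains[OF \<pi>] avoidersD[OF \<pi>] that by auto
    qed (use avoidersD[OF \<pi>] in auto)
  qed
  have "avoiders n (rev ` \<Sigma>) = rev ` avoiders n \<Sigma>"
  proof
    have "rev ` avoiders n (rev ` \<Sigma>) \<subseteq> avoiders n \<Sigma>"
      using sub[of "rev ` \<Sigma>"] dist by (force simp: image_image)
    then have "rev ` rev ` avoiders n (rev ` \<Sigma>) \<subseteq> rev ` avoiders n \<Sigma>" by (rule image_mono)
    then show "avoiders n (rev ` \<Sigma>) \<subseteq> rev ` avoiders n \<Sigma>" by (simp add: image_image)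
  qed (rule sub[OF dist])
  moreover have "sign_balanced (rev ` avoiders n \<Sigma>)"
  proof (rule sign_balanced_image[OF assms(1)])
    fix \<pi> assume "\<pi> \<in> avoiders n \<Sigma>"
    \<comment> \<open>The two inversion counts add up to a number determined by \<open>n\<close>, so
      reversal keeps all signs or flips all of them.\<close>
    from avoidersD[OF this] coinversions_card[of \<pi>]
    have "card (inversions \<pi>) + card (inversions (rev \<pi>)) = card {(i, j). i < j \<and> j < n}"
      by (simp add: card_inversions_rev)
    then show "even_perm (rev \<pi>) \<longleftrightarrow> (even_perm \<pi> \<longleftrightarrow> even (card {(i, j). i < j \<and> j < n}))"
      unfolding even_perm_def by (metis even_add)
  qed auto
  ultimately show ?thesis by simp
qed

text \<open>Patterns are complemented by \<open>m - x\<close> and permutations by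
  \<open>Suc n - x\<close>. The bound on the pattern entries makes the truncated subtraction an
  involution on them.\<close>

lemma sign_balanced_avoiders_complement:
  assumes "sign_balanced (avoiders n \<Sigma>)"
    and \<Sigma>: "\<And>\<sigma>. \<sigma> \<in> \<Sigma> \<Longrightarrow> distinct \<sigma> \<and> set \<sigma> \<subseteq> {..m}"
  shows "sign_balanced (avoiders n (map (\<lambda>x. m - x) ` \<Sigma>))"
proof -
  define c where "c = (\<lambda>k. map (\<lambda>x::nat. k - x))"
  have cc: "c k (c k xs) = xs" if "set xs \<subseteq> {..k}" for k xs
    using that by (auto simp: c_def intro!: map_idI)
  have dist: "distinct (c k xs) \<longleftrightarrow> distinct xs" if "set xs \<subseteq> {..k}" for k xs
    using that by (auto simp: c_def distinct_map inj_on_def subset_iff) (metis diff_diff_cancel)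
  have image: "(\<lambda>x. Suc n - x) ` {1..n} = {1..n}"
  proof -
    have "x \<in> (\<lambda>x. Suc n - x) ` {1..n}" if "x \<in> {1..n}" for x
      using that by (intro image_eqI[of _ _ "Suc n - x"]) auto
    then show ?thesis by auto
  qed
  have sub: "c (Suc n) ` avoiders n S \<subseteq> avoiders n (c m ` S)"
    if S: "\<And>\<sigma>. \<sigma> \<in> S \<Longrightarrow> distinct \<sigma> \<and> set \<sigma> \<subseteq> {..m}" for S
  proof clarify
    fix \<pi> assume \<pi>: "\<pi> \<in> avoiders n S"
    note * = avoidersD[OF this]
    have set: "set (c (Suc n) \<pi>) = {1..n}" using image * by (simp add: c_def)
    then have dist': "distinct (c (Suc n) \<pi>)" using dist[of \<pi> "Suc n"] * by auto
    show "c (Suc n) \<pi> \<in> avoiders n (c m ` S)"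
    proof (rule avoidersI[OF dist' set])
      fix \<sigma> assume "\<sigma> \<in> c m ` S"
      then obtain \<tau> where \<tau>: "\<sigma> = c m \<tau>" "\<tau> \<in> S" by blast
      show "\<not> contains_pattern (c (Suc n) \<pi>) \<sigma>"
      proof
        assume "contains_pattern (c (Suc n) \<pi>) \<sigma>"
        \<comment> \<open>Complementing a second time restores \<open>\<pi>\<close> and
          \<open>\<tau>\<close>, which contradicts avoidance of \<open>\<tau>\<close>.\<close>
        then have "contains_pattern (c (Suc n) (c (Suc n) \<pi>)) (c m (c m \<tau>))"
          unfolding \<tau>(1) c_def
        proof (rule contains_map_antimono, goal_cases)
          case 1 then show ?case using dist' by (simp add: c_def)
        next
          case 2 then show ?case using dist[of \<tau> m] S \<tau> by (simp add: c_def)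
        next
          case 3 then show ?case using set by (auto simp: c_def)
        qed (use S \<tau> in auto)
        then show False using cc[of \<pi> "Suc n"] cc[of \<tau> m] S[of \<tau>] \<tau> * avoiders_not_contains[OF \<pi>]
          by auto
      qed
    qed
  qed
  have "avoiders n (c m ` \<Sigma>) = c (Suc n) ` avoiders n \<Sigma>"
  proof
    have \<Sigma>': "distinct \<sigma> \<and> set \<sigma> \<subseteq> {..m}" if "\<sigma> \<in> c m ` \<Sigma>" for \<sigma>
      using that \<Sigma> dist by (auto simp: c_def)
    have "c m ` c m ` \<Sigma> = \<Sigma>"
      using cc \<Sigma> by (simp add: image_image cong: image_cong)
    then have "c (Suc n) ` avoiders n (c m ` \<Sigma>) \<subseteq> avoiders n \<Sigma>"
      using sub[of "c m ` \<Sigma>", OF \<Sigma>'] by simp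
    then have "c (Suc n) ` c (Suc n) ` avoiders n (c m ` \<Sigma>) \<subseteq> c (Suc n) ` avoiders n \<Sigma>"
      by (rule image_mono)
    moreover have "c (Suc n) (c (Suc n) \<pi>) = \<pi>" if "\<pi> \<in> avoiders n (c m ` \<Sigma>)" for \<pi>
      using avoidersD(2)[OF that] by (intro cc) auto
    ultimately show "avoiders n (c m ` \<Sigma>) \<subseteq> c (Suc n) ` avoiders n \<Sigma>"
      by (simp add: image_image cong: image_cong)
  qed (rule sub[OF \<Sigma>])
  moreover have "sign_balanced (c (Suc n) ` avoiders n \<Sigma>)"
  proof (rule sign_balanced_image[OF assms(1)])
    show "inj_on (c (Suc n)) (avoiders n \<Sigma>)"
    proof (rule inj_on_inverseI)
      fix \<pi> assume "\<pi> \<in> avoiders n \<Sigma>"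
      then show "c (Suc n) (c (Suc n) \<pi>) = \<pi>" using avoidersD(2) by (intro cc) auto
    qed
    fix \<pi> assume "\<pi> \<in> avoiders n \<Sigma>"
    note * = avoidersD[OF this]
    have "inversions (c (Suc n) \<pi>) = {(i, j). i < j \<and> j < length \<pi> \<and> \<pi> ! i < \<pi> ! j}"
      unfolding c_def using * by (intro inversions_map_antimono) auto
    then have "card (inversions \<pi>) + card (inversions (c (Suc n) \<pi>)) = card {(i, j). i < j \<and> j < n}"
      using coinversions_card[of \<pi>] * by simp
    then show "even_perm (c (Suc n) \<pi>) \<longleftrightarrow> (even_perm \<pi> \<longleftrightarrow> even (card {(i, j). i < j \<and> j < n}))"
      unfolding even_perm_def by (metis even_add)
  qed
  ultimately show ?thesis by (simp add: c_def)
qed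

section \<open>Avoiding 1234 and 3214 as a zigzag condition\<close>

lemma pairs_less_4: "(s::nat) < t \<Longrightarrow> t < 4 \<Longrightarrow> (s, t) \<in> {(0, 1), (0, 2), (0, 3), (1, 2), (1, 3), (2, 3)}"
  by (auto simp: less_Suc_eq numeral_eq_Suc)

text \<open>Replaces the position function by four explicit indices, so that containment reduces to
  six comparisons of entries.\<close>

lemma contains_pattern_4:
  "contains_pattern \<pi> [w, x, y, z] \<longleftrightarrow>
    (\<exists>i j k l. i < j \<and> j < k \<and> k < l \<and> l < length \<pi> \<and>
      (\<pi> ! i > \<pi> ! j \<longleftrightarrow> w > x) \<and> (\<pi> ! i > \<pi> ! k \<longleftrightarrow> w > y) \<and> (\<pi> ! i > \<pi> ! l \<longleftrightarrow> w > z) \<and>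
      (\<pi> ! j > \<pi> ! k \<longleftrightarrow> x > y) \<and> (\<pi> ! j > \<pi> ! l \<longleftrightarrow> x > z) \<and> (\<pi> ! k > \<pi> ! l \<longleftrightarrow> y > z))"
    (is "_ \<longleftrightarrow> ?R")
proof
  assume cont: "contains_pattern \<pi> [w, x, y, z]"
  define \<sigma> where "\<sigma> = [w, x, y, z]"
  have "length \<sigma> = 4" by (simp add: \<sigma>_def)
  with cont obtain i where mono: "strict_mono_on {..<4} i" and len: "\<And>s. s < 4 \<Longrightarrow> i s < length \<pi>"
    and ord: "\<And>s t. s < t \<Longrightarrow> t < 4 \<Longrightarrow> \<pi> ! i s > \<pi> ! i t \<longleftrightarrow> \<sigma> ! s > \<sigma> ! t"
    unfolding contains_pattern_def \<sigma>_def[symmetric] by auto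
  have "i 0 < i 1" "i 1 < i 2" "i 2 < i 3" using mono by (auto simp: strict_mono_on_def)
  then show ?R
    using len[of 3] ord[of 0 1] ord[of 0 2] ord[of 0 3] ord[of 1 2] ord[of 1 3] ord[of 2 3]
    by - (rule exI[of _ "i 0"], rule exI[of _ "i 1"], rule exI[of _ "i 2"], rule exI[of _ "i 3"],
      simp add: \<sigma>_def)
next
  assume ?R
  then obtain i j k l where "i < j" "j < k" "k < l" "l < length \<pi>"
      "(\<pi> ! i > \<pi> ! j \<longleftrightarrow> w > x) \<and> (\<pi> ! i > \<pi> ! k \<longleftrightarrow> w > y) \<and> (\<pi> ! i > \<pi> ! l \<longleftrightarrow> w > z) \<and>
      (\<pi> ! j > \<pi> ! k \<longleftrightarrow> x > y) \<and> (\<pi> ! j > \<pi> ! l \<longleftrightarrow> x > z) \<and> (\<pi> ! k > \<pi> ! l \<longleftrightarrow> y > z)"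
    by blast
  note * = this
  show "contains_pattern \<pi> [w, x, y, z]"
    unfolding contains_pattern_def
  proof (intro exI[of _ "\<lambda>s. [i, j, k, l] ! s"] conjI allI impI strict_mono_onI)
    fix s t assume "t \<in> {..<length [w, x, y, z]}" "s < t"
    then have "(s, t) \<in> {(0, 1), (0, 2), (0, 3), (1, 2), (1, 3), (2, 3)}" by (intro pairs_less_4) simp_all
    then show "[i, j, k, l] ! s < [i, j, k, l] ! t" using * by (elim insertE) simp_all
  next
    fix s assume "s < length [w, x, y, z]"
    then have "s \<in> {0, 1, 2, 3}" by (auto simp: less_Suc_eq numeral_eq_Suc)
    then show "[i, j, k, l] ! s < length \<pi>" using *(1-4) by (elim insertE) simp_all
  next
    fix s t assume "s < t \<and> t < length [w, x, y, z]"
    then have "(s, t) \<in> {(0, 1), (0, 2), (0, 3), (1, 2), (1, 3), (2, 3)}" by (intro pairs_less_4) simp_all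
    then show "\<pi> ! ([i, j, k, l] ! t) < \<pi> ! ([i, j, k, l] ! s) \<longleftrightarrow> [w, x, y, z] ! t < [w, x, y, z] ! s"
      using *(5) by (elim insertE) simp_all
  qed
qed

text \<open>For a list with distinct entries, this says that it avoids 1234 and 3214: the last entry of
  either pattern is its maximum, and the other three entries are monotone.\<close>

definition zigzag_below :: "nat list \<Rightarrow> bool" where
  "zigzag_below \<pi> \<longleftrightarrow>
    (\<forall>i j k l. i < j \<and> j < k \<and> k < l \<and> l < length \<pi> \<and> \<pi> ! i < \<pi> ! l \<and> \<pi> ! j < \<pi> ! l \<and> \<pi> ! k < \<pi> ! l \<longrightarrow>
      (\<pi> ! i < \<pi> ! j \<longleftrightarrow> \<pi> ! k < \<pi> ! j))"

lemma zigzag_belowD: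
  "zigzag_below \<pi> \<Longrightarrow> i < j \<Longrightarrow> j < k \<Longrightarrow> k < l \<Longrightarrow> l < length \<pi> \<Longrightarrow>
    \<pi> ! i < \<pi> ! l \<Longrightarrow> \<pi> ! j < \<pi> ! l \<Longrightarrow> \<pi> ! k < \<pi> ! l \<Longrightarrow> \<pi> ! i < \<pi> ! j \<longleftrightarrow> \<pi> ! k < \<pi> ! j"
  unfolding zigzag_below_def by blast

lemma zigzag_below_iff:
  assumes "distinct \<pi>"
  shows "zigzag_below \<pi> \<longleftrightarrow>
    \<not> contains_pattern \<pi> [1, 2, 3, 4] \<and> \<not> contains_pattern \<pi> [3, 2, 1, 4]"
proof -
  have ne: "\<pi> ! i \<noteq> \<pi> ! j" if "i < j" "j < length \<pi>" for i j
    using assms that by (simp add: nth_eq_iff_index_eq)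
  show ?thesis
  proof (intro iffI conjI notI)
    assume z: "zigzag_below \<pi>" and "contains_pattern \<pi> [1, 2, 3, 4]"
    then obtain i j k l where *: "i < j" "j < k" "k < l" "l < length \<pi>"
      "\<not> \<pi> ! i > \<pi> ! j" "\<not> \<pi> ! j > \<pi> ! k" "\<not> \<pi> ! k > \<pi> ! l"
      unfolding contains_pattern_4 by auto
    then show False using zigzag_belowD[OF z *(1-4)] ne[of i j] ne[of j k] ne[of k l] by linarith
  next
    assume z: "zigzag_below \<pi>" and "contains_pattern \<pi> [3, 2, 1, 4]"
    then obtain i j k l where *: "i < j" "j < k" "k < l" "l < length \<pi>"
      "\<pi> ! i > \<pi> ! j" "\<pi> ! j > \<pi> ! k" "\<not> \<pi> ! i > \<pi> ! l"
      unfolding contains_pattern_4 by auto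
    then show False using zigzag_belowD[OF z *(1-4)] ne[of i l] by linarith
  next
    assume av: "\<not> contains_pattern \<pi> [1, 2, 3, 4] \<and> \<not> contains_pattern \<pi> [3, 2, 1, 4]"
    show "zigzag_below \<pi>"
      unfolding zigzag_below_def
    proof (intro allI impI, elim conjE, rule ccontr)
      fix i j k l
      assume *: "i < j" "j < k" "k < l" "l < length \<pi>"
        and lt: "\<pi> ! i < \<pi> ! l" "\<pi> ! j < \<pi> ! l" "\<pi> ! k < \<pi> ! l"
        and "(\<pi> ! i < \<pi> ! j) \<noteq> (\<pi> ! k < \<pi> ! j)"
      \<comment> \<open>For distinct entries, failure of the equivalence means that the triple is
        monotone.\<close>
      then consider "\<pi> ! i < \<pi> ! j" "\<pi> ! j < \<pi> ! k" | "\<pi> ! i > \<pi> ! j" "\<pi> ! j > \<pi> ! k"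
        using ne[of i j] ne[of j k] by linarith
      then show False
      proof cases
        case 1
        then have "contains_pattern \<pi> [1, 2, 3, 4]"
          unfolding contains_pattern_4 using * lt
          by - (rule exI[of _ i], rule exI[of _ j], rule exI[of _ k], rule exI[of _ l], auto)
        then show False using av by blast
      next
        case 2
        then have "contains_pattern \<pi> [3, 2, 1, 4]"
          unfolding contains_pattern_4 using * lt
          by - (rule exI[of _ i], rule exI[of _ j], rule exI[of _ k], rule exI[of _ l], auto)
        then show False using av by blast
      qed
    qed
  qed
qed

text \<open>A leading maximum is below no other entry, so it belongs to no triple that the condition
  restricts; all remaining indices shift by one.\<close>

lemma zigzag_below_Cons_max:
  assumes "\<And>x. x \<in> set \<pi> \<Longrightarrow> x < m"
  shows "zigzag_below (m # \<pi>) \<longleftrightarrow> zigzag_below \<pi>"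
proof
  assume z: "zigzag_below (m # \<pi>)"
  show "zigzag_below \<pi>"
    unfolding zigzag_below_def
  proof (intro allI impI, elim conjE)
    fix i j k l
    assume "i < j" "j < k" "k < l" "l < length \<pi>" "\<pi> ! i < \<pi> ! l" "\<pi> ! j < \<pi> ! l" "\<pi> ! k < \<pi> ! l"
    then show "\<pi> ! i < \<pi> ! j \<longleftrightarrow> \<pi> ! k < \<pi> ! j"
      using zigzag_belowD[OF z, of "Suc i" "Suc j" "Suc k" "Suc l"] by simp
  qed
next
  assume z: "zigzag_below \<pi>"
  show "zigzag_below (m # \<pi>)"
    unfolding zigzag_below_def
  proof (intro allI impI, elim conjE)
    fix i j k l
    let ?\<rho> = "m # \<pi>"
    assume *: "i < j" "j < k" "k < l" "l < length ?\<rho>" "?\<rho> ! i < ?\<rho> ! l" "?\<rho> ! j < ?\<rho> ! l" "?\<rho> ! k < ?\<rho> ! l"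
    have "i \<noteq> 0"
    proof
      assume "i = 0"
      then have "m < \<pi> ! (l - 1)" "l - 1 < length \<pi>" using * by (cases l; simp)+
      then show False using assms[of "\<pi> ! (l - 1)"] by simp
    qed
    then obtain i' j' k' l' where "i = Suc i'" "j = Suc j'" "k = Suc k'" "l = Suc l'"
      using * by (metis not0_implies_Suc not_less_zero)
    then show "?\<rho> ! i < ?\<rho> ! j \<longleftrightarrow> ?\<rho> ! k < ?\<rho> ! j"
      using * zigzag_belowD[OF z, of i' j' k' l'] by simp
  qed
qed

section \<open>The involution when the maximum does not lead\<close>

text \<open>For distinct entries the equivalence says that \<open>\<pi> ! 2\<close> is the median of
  the first three. Positions count from 0, so \<open>\<pi> ! 3\<close> is the fourth entry.\<close>

definition swap_pos :: "nat list \<Rightarrow> nat" where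
  "swap_pos \<pi> =
    (if 3 < length \<pi> \<and> \<pi> ! 3 = Max (set \<pi>) \<and> (\<pi> ! 0 < \<pi> ! 2 \<longleftrightarrow> \<pi> ! 2 < \<pi> ! 1) then 0 else 1)"

text \<open>All entries before the maximum are below it, so they contain no monotone triple and
  number at most four. If the maximum is in position 3, the second entry is the largest or smallest
  of the first three, so their median is the third entry (\<open>left\<close>) or the first
  (\<open>right\<close>).\<close>

lemma swap_pos_cases:
  assumes "distinct \<pi>" "zigzag_below \<pi>" "3 \<le> length \<pi>" "\<pi> ! 0 \<noteq> Max (set \<pi>)"
  obtains (inner) m where "m < length \<pi>" "m \<in> {1, 2, 4}" "\<pi> ! m = Max (set \<pi>)" "swap_pos \<pi> = 1"
  | (left) "3 < length \<pi>" "\<pi> ! 3 = Max (set \<pi>)" "swap_pos \<pi> = 0" "\<pi> ! 0 < \<pi> ! 2 \<longleftrightarrow> \<pi> ! 2 < \<pi> ! 1"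
  | (right) "3 < length \<pi>" "\<pi> ! 3 = Max (set \<pi>)" "swap_pos \<pi> = 1" "\<pi> ! 1 < \<pi> ! 0 \<longleftrightarrow> \<pi> ! 0 < \<pi> ! 2"
proof -
  have "Max (set \<pi>) \<in> set \<pi>" using assms(3) by (intro Max_in) auto
  then obtain m where m: "m < length \<pi>" "\<pi> ! m = Max (set \<pi>)" by (metis in_set_conv_nth)
  have ne: "\<pi> ! i \<noteq> \<pi> ! j" if "i < j" "j < length \<pi>" for i j
    using assms(1) that by (simp add: nth_eq_iff_index_eq)
  have max: "\<pi> ! i < \<pi> ! m" if "i < m" for i
  proof -
    have "\<pi> ! i \<le> Max (set \<pi>)" using that m(1) by (intro Max_ge) auto
    then show ?thesis using ne[OF that m(1)] m(2) by simp
  qed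
  have z: "\<pi> ! i < \<pi> ! j \<longleftrightarrow> \<pi> ! k < \<pi> ! j" if "i < j" "j < k" "k < m" for i j k
    using that m max by (intro zigzag_belowD[OF assms(2), of _ _ _ m]) auto
  \<comment> \<open>A small case of Erdos-Szekeres: if \<open>\<pi> ! 0 < \<pi> ! 1\<close>, the
    entries in positions 2, 3, 4 all lie below \<open>\<pi> ! 1\<close>, hence must increase, and so
    form a monotone triple themselves. The other case is dual.\<close>
  have "m < 5"
  proof (rule ccontr)
    assume "\<not> m < 5"
    then show False
      using z[of 0 1 2] z[of 0 1 3] z[of 0 1 4] z[of 0 2 3] z[of 1 2 3] z[of 1 2 4] z[of 1 3 4] z[of 2 3 4]
        ne[of 0 1] ne[of 1 2] ne[of 1 3] ne[of 1 4] ne[of 2 3] ne[of 2 4] ne[of 3 4] m(1) by auto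
  qed
  moreover have "m \<noteq> 0" using assms(4) m(2) by (metis)
  ultimately have "m \<in> {1, 2, 4} \<or> m = 3" by auto
  then show thesis
  proof
    assume "m \<in> {1, 2, 4}"
    moreover from this have "swap_pos \<pi> = 1"
      using m ne[of m 3] ne[of 3 m] by (auto simp: swap_pos_def)
    ultimately show thesis using inner m by blast
  next
    assume m3: "m = 3"
    show thesis
    proof (cases "\<pi> ! 0 < \<pi> ! 2 \<longleftrightarrow> \<pi> ! 2 < \<pi> ! 1")
      case True
      then show thesis using left m m3 by (simp add: swap_pos_def)
    next
      case False
      then have "\<pi> ! 1 < \<pi> ! 0 \<longleftrightarrow> \<pi> ! 0 < \<pi> ! 2"
        using z[of 0 1 2] m3 m ne[of 0 1] ne[of 1 2] ne[of 0 2] by auto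
      then show thesis using right m m3 False by (simp add: swap_pos_def)
    qed
  qed
qed

text \<open>If the maximum is in position 3 or 4, the one entry of the first three that stays in
  place is their median, and the swap exchanges the two extremes. An entry above both extremes is
  above the median too, so the median can be used in zigzag triples. If the maximum is in position 1
  or 2, it is itself swapped, and no restricted triple contains both swapped entries.\<close>

lemma swap_adj_swap_pos:
  assumes "distinct \<pi>" "zigzag_below \<pi>" "3 \<le> length \<pi>" "\<pi> ! 0 \<noteq> Max (set \<pi>)"
  shows "zigzag_below (swap_adj (swap_pos \<pi>) \<pi>)" (is ?zigzag)
    and "swap_pos (swap_adj (swap_pos \<pi>) \<pi>) = swap_pos \<pi>" (is ?pos)
    and "swap_adj (swap_pos \<pi>) \<pi> ! 0 \<noteq> Max (set \<pi>)" (is ?zero)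
proof -
  define p where "p = swap_pos \<pi>"
  have p: "p = 0 \<or> p = 1" "Suc p < length \<pi>" using assms(3) by (auto simp: p_def swap_pos_def)
  have ne: "\<pi> ! i \<noteq> \<pi> ! j" if "i < j" "j < length \<pi>" for i j
    using assms(1) that by (simp add: nth_eq_iff_index_eq)
  have le: "\<pi> ! i \<le> Max (set \<pi>)" if "i < length \<pi>" for i
    using that by (intro Max_ge) auto
  note z = zigzag_belowD[OF assms(2)]
  let ?t = "transpose p (Suc p)"
  have nth: "swap_adj p \<pi> ! i = \<pi> ! ?t i" if "i < length \<pi>" for i
    using that p by (simp add: nth_swap_adj)
  have t_less: "?t i < ?t j" if "i < j" "(i, j) \<noteq> (p, Suc p)" for i j
    using that by (auto simp: transpose_def)
  show ?zigzag
    unfolding zigzag_below_def p_def[symmetric] length_swap_adj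
  proof (intro allI impI, elim conjE)
    fix i j k l
    assume ijkl: "i < j" "j < k" "k < l" "l < length \<pi>"
    \<comment> \<open>Only positions 0 to 2 can move, while three positions precede
      \<open>l\<close>.\<close>
    then have tl: "?t l = l" "l \<ge> 3" using p(1) by (auto simp: transpose_def)
    have n: "swap_adj p \<pi> ! i = \<pi> ! ?t i" "swap_adj p \<pi> ! j = \<pi> ! ?t j"
      "swap_adj p \<pi> ! k = \<pi> ! ?t k" "swap_adj p \<pi> ! l = \<pi> ! l"
      using ijkl nth tl by auto
    assume "swap_adj p \<pi> ! i < swap_adj p \<pi> ! l" "swap_adj p \<pi> ! j < swap_adj p \<pi> ! l"
      "swap_adj p \<pi> ! k < swap_adj p \<pi> ! l"
    note lt = this[unfolded n]
    have max_l: "\<pi> ! ?t i < Max (set \<pi>)" "\<pi> ! ?t j < Max (set \<pi>)" "\<pi> ! ?t k < Max (set \<pi>)"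
      using lt le[OF ijkl(4)] by auto
    show "swap_adj p \<pi> ! i < swap_adj p \<pi> ! j \<longleftrightarrow> swap_adj p \<pi> ! k < swap_adj p \<pi> ! j"
      unfolding n
    proof -
      \<comment> \<open>The swapped positions are adjacent, so \<open>i\<close> and \<open>k\<close>
        cannot be both of them. In the case \<open>disjoint\<close> at most one of them is in the
        triple, and the moved triple keeps its order.\<close>
      consider (disjoint) "(i, j) \<noteq> (p, Suc p)" "(j, k) \<noteq> (p, Suc p)"
        | (first) "i = p" "j = Suc p" | (last) "j = p" "k = Suc p" by auto
      then show "\<pi> ! ?t i < \<pi> ! ?t j \<longleftrightarrow> \<pi> ! ?t k < \<pi> ! ?t j"
      proof cases
        case disjoint
        have "?t k < l" using t_less[of k l] ijkl tl p(1) by auto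
        then show ?thesis using disjoint ijkl lt by (intro z[of _ _ _ l] t_less) auto
      next
        case first
        have tk: "?t k = k" "?t i = Suc p" "?t j = p"
          using first ijkl by (auto simp: transpose_def)
        note max_l = max_l[unfolded tk] and lt = lt[unfolded tk]
        have nek: "\<pi> ! k \<noteq> \<pi> ! p" using ne[of p k] first ijkl by auto
        show ?thesis
          unfolding tk
          using assms
        proof (cases rule: swap_pos_cases)
          case (inner m)
          have p1: "p = 1" "Suc p = 2" using inner p_def by auto
          \<comment> \<open>By \<open>max_l\<close> the maximum is not one of the swapped entries in
            positions 1 and 2.\<close>
          then have m: "m = 4" using inner max_l by (auto simp: numeral_2_eq_2)
          have below: "\<pi> ! u < \<pi> ! 4" if "u < 4" for u
            using le[of u] ne[of u 4] that inner(1,3) unfolding m by linarith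
          \<comment> \<open>These triples below the maximum make \<open>\<pi> ! 0\<close> the median
            of the first three, so it lies below \<open>\<pi> ! l\<close>. The triple
            \<open>0, 1, k\<close> then decides the goal.\<close>
          have z4: "\<pi> ! 0 < \<pi> ! 1 \<longleftrightarrow> \<pi> ! 2 < \<pi> ! 1" "\<pi> ! 0 < \<pi> ! 2 \<longleftrightarrow> \<pi> ! 3 < \<pi> ! 2"
            "\<pi> ! 1 < \<pi> ! 2 \<longleftrightarrow> \<pi> ! 3 < \<pi> ! 2" "\<pi> ! 0 < \<pi> ! 1 \<longleftrightarrow> \<pi> ! 3 < \<pi> ! 1"
            using below inner m by (intro z[of _ _ _ 4]; simp)+
          have "\<pi> ! 0 < \<pi> ! l \<Longrightarrow> \<pi> ! 0 < \<pi> ! 1 \<longleftrightarrow> \<pi> ! k < \<pi> ! 1"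
            using ijkl lt first p1 by (intro z[of 0 1 k l]) auto
          moreover have "\<pi> ! 0 \<noteq> \<pi> ! 1" "\<pi> ! 0 \<noteq> \<pi> ! 2" "\<pi> ! 1 \<noteq> \<pi> ! 2" using ne tl ijkl by auto
          ultimately show "\<pi> ! Suc p < \<pi> ! p \<longleftrightarrow> \<pi> ! k < \<pi> ! p"
            using z4 lt nek unfolding p1(2) unfolding p1(1) by linarith
        next
          case left
          have p0: "p = 0" "Suc p = 1" using left p_def by auto
          have nes: "\<pi> ! 0 \<noteq> \<pi> ! 1" "\<pi> ! 0 \<noteq> \<pi> ! 2" "\<pi> ! 1 \<noteq> \<pi> ! 2" using ne tl ijkl by auto
          show "\<pi> ! Suc p < \<pi> ! p \<longleftrightarrow> \<pi> ! k < \<pi> ! p"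
          proof (cases "k = 2")
            case True
            then show ?thesis using left nes unfolding True p0(2) unfolding p0(1) by linarith
          next
            case False
            \<comment> \<open>The median \<open>\<pi> ! 2\<close> lies between the two swapped
              entries, both below \<open>\<pi> ! l\<close>; hence the triple \<open>1, 2, k\<close>
              is restricted.\<close>
            have "\<pi> ! 2 < \<pi> ! l" using left nes lt unfolding p0(2) unfolding p0(1) by linarith
            then have "\<pi> ! 1 < \<pi> ! 2 \<longleftrightarrow> \<pi> ! k < \<pi> ! 2"
              using ijkl lt first p0 False by (intro z[of 1 2 k l]) auto
            moreover have "\<pi> ! k \<noteq> \<pi> ! 2" using ne[of 2 k] False first p0 ijkl by auto
            ultimately show ?thesis using left nes nek unfolding p0(2) unfolding p0(1) by linarith
          qed
        next
          case right
          have p1: "p = 1" "Suc p = 2" using right p_def by auto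
          have nes: "\<pi> ! 0 \<noteq> \<pi> ! 1" "\<pi> ! 0 \<noteq> \<pi> ! 2" "\<pi> ! 1 \<noteq> \<pi> ! 2" using ne tl ijkl by auto
          \<comment> \<open>Now \<open>\<pi> ! 0\<close> is the median of the first three, and the
            triple \<open>0, 1, k\<close> is restricted.\<close>
          have "\<pi> ! 0 < \<pi> ! l" using right nes lt unfolding p1(2) unfolding p1(1) by linarith
          then have "\<pi> ! 0 < \<pi> ! 1 \<longleftrightarrow> \<pi> ! k < \<pi> ! 1"
            using ijkl lt first p1 by (intro z[of 0 1 k l]) auto
          then show "\<pi> ! Suc p < \<pi> ! p \<longleftrightarrow> \<pi> ! k < \<pi> ! p"
            using right nes nek unfolding p1(2) unfolding p1(1) by linarith
        qed
      next
        case last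
        then have ijk: "p = 1" "i = 0" "j = 1" "k = 2" using ijkl p(1) by auto
        then have tk: "?t i = 0" "?t j = 2" "?t k = 1" by (auto simp: transpose_def)
        note max_l = max_l[unfolded tk]
        have nes: "\<pi> ! 0 \<noteq> \<pi> ! 1" "\<pi> ! 0 \<noteq> \<pi> ! 2" "\<pi> ! 1 \<noteq> \<pi> ! 2" using ne tl ijkl by auto
        show ?thesis
          unfolding tk
          using assms
        proof (cases rule: swap_pos_cases)
          case (inner m)
          then have m: "m = 4" using inner max_l by auto
          have below: "\<pi> ! u < \<pi> ! 4" if "u < 4" for u
            using le[of u] ne[of u 4] that inner(1,3) unfolding m by linarith
          have "\<pi> ! 0 < \<pi> ! 2 \<longleftrightarrow> \<pi> ! 3 < \<pi> ! 2" "\<pi> ! 1 < \<pi> ! 2 \<longleftrightarrow> \<pi> ! 3 < \<pi> ! 2"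
            using below inner m by (intro z[of _ _ _ 4]; simp)+
          then show "\<pi> ! 0 < \<pi> ! 2 \<longleftrightarrow> \<pi> ! 1 < \<pi> ! 2" by blast
        next
          case left
          then show "\<pi> ! 0 < \<pi> ! 2 \<longleftrightarrow> \<pi> ! 1 < \<pi> ! 2" using ijk p_def by simp
        next
          case right
          then show "\<pi> ! 0 < \<pi> ! 2 \<longleftrightarrow> \<pi> ! 1 < \<pi> ! 2" using nes by linarith
        qed
      qed
    qed
  qed
  have set: "set (swap_adj p \<pi>) = set \<pi>" using p by simp
  have nes: "\<pi> ! 0 \<noteq> \<pi> ! 1" "\<pi> ! 0 \<noteq> \<pi> ! 2" "\<pi> ! 1 \<noteq> \<pi> ! 2" using ne assms(3) by auto
  have nth3: "swap_adj p \<pi> ! 3 = \<pi> ! 3" if "3 < length \<pi>"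
    using nth[OF that] p(1) by (auto simp: transpose_def)
  have len: "0 < length \<pi>" "1 < length \<pi>" "2 < length \<pi>" using assms(3) by linarith+
  have nth0: "swap_adj p \<pi> ! 0 = (if p = 0 then \<pi> ! 1 else \<pi> ! 0)"
    and nth1: "swap_adj p \<pi> ! 1 = (if p = 0 then \<pi> ! 0 else \<pi> ! 2)"
    and nth2: "swap_adj p \<pi> ! 2 = (if p = 0 then \<pi> ! 2 else \<pi> ! 1)"
    using p(1) nth[OF len(1)] nth[OF len(2)] nth[OF len(3)]
    by (auto simp: transpose_def numeral_2_eq_2)
  show ?pos
    unfolding p_def[symmetric]
    using assms
  proof (cases rule: swap_pos_cases)
    case (inner m)
    \<comment> \<open>Position 3 is not moved, so the maximum stays out of it.\<close>
    then have "swap_adj p \<pi> ! 3 \<noteq> Max (set \<pi>)" if "3 < length \<pi>"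
      using nth3[OF that] that ne[of m 3] ne[of 3 m] by auto
    then show "swap_pos (swap_adj p \<pi>) = p" using inner set by (auto simp: swap_pos_def p_def)
  next
    case left
    then have "p = 0" by (simp add: p_def)
    \<comment> \<open>Exchanging the first two entries leaves the third one the median.\<close>
    moreover have "\<pi> ! 1 < \<pi> ! 2 \<longleftrightarrow> \<pi> ! 2 < \<pi> ! 0" using left nes by linarith
    ultimately show "swap_pos (swap_adj p \<pi>) = p"
      using nth0 nth1 nth2 nth3 left set by (simp add: swap_pos_def)
  next
    case right
    then have "p = 1" by (simp add: p_def)
    \<comment> \<open>The new third entry is \<open>\<pi> ! 1\<close>, an extreme of the first
      three, so the median test still fails.\<close>
    moreover have "\<not> (\<pi> ! 0 < \<pi> ! 1 \<longleftrightarrow> \<pi> ! 1 < \<pi> ! 2)" using right nes by linarith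
    ultimately show "swap_pos (swap_adj p \<pi>) = p"
      using nth0 nth1 nth2 nth3 right set by (simp add: swap_pos_def)
  qed
  show ?zero
    unfolding p_def[symmetric]
    using assms
  proof (cases rule: swap_pos_cases)
    case left
    \<comment> \<open>The new head is \<open>\<pi> ! 1\<close>, while the maximum is in position
      3.\<close>
    then show "swap_adj p \<pi> ! 0 \<noteq> Max (set \<pi>)" using ne[of 1 3] nth0 by (simp add: p_def)
  qed (use nth0 assms(4) in \<open>simp_all add: p_def\<close>)
qed

section \<open>Induction on the length for 1234 and 3214\<close>

text \<open>The leading maximum is inverted with every later entry (\<open>?A\<close>); the
  inversions of the tail shift by one position (\<open>?B\<close>).\<close>

lemma card_inversions_Cons_max:
  assumes "\<And>x. x \<in> set \<pi> \<Longrightarrow> x < m"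
  shows "card (inversions (m # \<pi>)) = length \<pi> + card (inversions \<pi>)"
proof -
  let ?A = "(\<lambda>j. (0::nat, Suc j)) ` {..<length \<pi>}" and ?B = "map_prod Suc Suc ` inversions \<pi>"
  have "inversions (m # \<pi>) = ?A \<union> ?B"
  proof (intro equalityI subsetI)
    fix x assume "x \<in> inversions (m # \<pi>)"
    then obtain i j where x: "x = (i, j)" "i < j" "j < Suc (length \<pi>)" "(m # \<pi>) ! i > (m # \<pi>) ! j"
      by (auto simp: inversions_def)
    then obtain j' where j: "j = Suc j'" by (cases j) auto
    show "x \<in> ?A \<union> ?B"
    proof (cases i)
      case 0
      then show ?thesis using x j by auto
    next
      case (Suc i')
      then have "(i', j') \<in> inversions \<pi>" using x j by (auto simp: inversions_def)
      then have "map_prod Suc Suc (i', j') \<in> ?B" by (rule imageI)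
      then show ?thesis using x j Suc by simp
    qed
  qed (use assms in \<open>auto simp: inversions_def\<close>)
  moreover have "?A \<inter> ?B = {}" by auto
  moreover have "card ?A = length \<pi>" by (subst card_image) (auto simp: inj_on_def)
  moreover have "card ?B = card (inversions \<pi>)" by (rule card_image) (auto simp: inj_on_def)
  ultimately show ?thesis by (simp add: card_Un_disjoint)
qed

lemma sign_balanced_avoiders_1234_3214:
  assumes "2 \<le> n"
  shows "sign_balanced (avoiders n {[1, 2, 3, 4], [3, 2, 1, 4]})"
  using assms
proof (induction n rule: nat_induct_at_least)
  case base
  show ?case
  \<comment> \<open>The closure condition is vacuous: a pattern of length 4 does not fit into length
    2.\<close>
  proof (rule sign_balanced_avoiders_swap[of 0])
    fix \<sigma> :: "nat list" and s :: nat
    assume "\<sigma> \<in> {[1, 2, 3, 4], [3, 2, 1, 4]}" "s \<le> 0" "length \<sigma> + 0 \<le> 2 + s"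
    moreover from this(1) have "length \<sigma> = 4" by auto
    ultimately show "swap_adj s \<sigma> \<in> {[1, 2, 3, 4], [3, 2, 1, 4]}" by linarith
  qed auto
next
  case (Suc n)
  let ?\<Sigma> = "{[1, 2, 3, 4], [3, 2, 1, 4]} :: nat list set"
  let ?A = "avoiders (Suc n) ?\<Sigma>"
  have avoiders: "\<pi> \<in> avoiders k ?\<Sigma> \<longleftrightarrow> distinct \<pi> \<and> set \<pi> = {1..k} \<and> zigzag_below \<pi>" for \<pi> k
  proof
    assume \<pi>: "\<pi> \<in> avoiders k ?\<Sigma>"
    show "distinct \<pi> \<and> set \<pi> = {1..k} \<and> zigzag_below \<pi>"
      unfolding zigzag_below_iff[OF avoidersD(1)[OF \<pi>]]
      by (intro conjI avoidersD[OF \<pi>] avoiders_not_contains[OF \<pi>] insertI1 insertI2)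
  next
    assume *: "distinct \<pi> \<and> set \<pi> = {1..k} \<and> zigzag_below \<pi>"
    show "\<pi> \<in> avoiders k ?\<Sigma>"
    proof (rule avoidersI)
      fix \<sigma> assume "\<sigma> \<in> ?\<Sigma>"
      then show "\<not> contains_pattern \<pi> \<sigma>"
        using * zigzag_below_iff[of \<pi>] by (elim insertE emptyE) simp_all
    qed (use * in simp_all)
  qed
  have max: "Max (set \<pi>) = Suc n" if "\<pi> \<in> ?A" for \<pi>
    unfolding avoidersD(2)[OF that] by (rule Max_eqI) auto
  have "sign_balanced {\<pi> \<in> ?A. \<pi> ! 0 = Suc n}"
  proof -
    have "{\<pi> \<in> ?A. \<pi> ! 0 = Suc n} = (#) (Suc n) ` avoiders n ?\<Sigma>"
    proof (intro equalityI subsetI)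
      fix \<pi> assume "\<pi> \<in> {\<pi> \<in> ?A. \<pi> ! 0 = Suc n}"
      then have \<pi>: "\<pi> \<in> ?A" "\<pi> ! 0 = Suc n" by auto
      then obtain \<rho> where \<rho>: "\<pi> = Suc n # \<rho>" using avoidersD(3)[OF \<pi>(1)] by (cases \<pi>) simp_all
      have dist: "distinct \<pi>" and set: "set \<pi> = {1..Suc n}" and zigzag: "zigzag_below \<pi>"
        using \<pi>(1) unfolding avoiders by simp_all
      have "set \<rho> = set \<pi> - {Suc n}" using dist unfolding \<rho> by simp
      also have "\<dots> = {1..n}" unfolding set by (simp add: atLeastAtMostSuc_conv)
      finally have set': "set \<rho> = {1..n}" .
      then have "zigzag_below \<rho>"
        using zigzag zigzag_below_Cons_max[of \<rho> "Suc n"] unfolding \<rho> by simp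
      then have "\<rho> \<in> avoiders n ?\<Sigma>" using set' dist unfolding \<rho> avoiders by simp
      then show "\<pi> \<in> (#) (Suc n) ` avoiders n ?\<Sigma>" unfolding \<rho> by (rule imageI)
    next
      fix \<pi> assume "\<pi> \<in> (#) (Suc n) ` avoiders n ?\<Sigma>"
      then obtain \<rho> where \<rho>: "\<pi> = Suc n # \<rho>" "\<rho> \<in> avoiders n ?\<Sigma>" by (rule imageE)
      then have "distinct \<rho>" "set \<rho> = {1..n}" "zigzag_below \<rho>" unfolding avoiders by simp_all
      then have "\<pi> \<in> ?A"
        using zigzag_below_Cons_max[of \<rho> "Suc n"] unfolding \<rho> avoiders
        by (simp add: atLeastAtMostSuc_conv)
      then show "\<pi> \<in> {\<pi> \<in> ?A. \<pi> ! 0 = Suc n}" using \<rho> by simp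
    qed
    moreover have "sign_balanced ((#) (Suc n) ` avoiders n ?\<Sigma>)"
    proof (rule sign_balanced_image[OF Suc.IH])
      fix \<pi> assume "\<pi> \<in> avoiders n ?\<Sigma>"
      note * = avoidersD[OF this]
      \<comment> \<open>Prepending the maximum adds \<open>n\<close> inversions whatever the tail
        is, so all signs change by one common factor.\<close>
      have "card (inversions (Suc n # \<pi>)) = n + card (inversions \<pi>)"
        using card_inversions_Cons_max[of \<pi> "Suc n"] unfolding *(2,3) by simp
      then show "even_perm (Suc n # \<pi>) \<longleftrightarrow> (even_perm \<pi> \<longleftrightarrow> even n)"
        unfolding even_perm_def by (metis even_add)
    qed simp
    ultimately show ?thesis by simp
  qed
  moreover have "sign_balanced {\<pi> \<in> ?A. \<pi> ! 0 \<noteq> Suc n}"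
  proof (rule sign_balanced_involution[where f = "\<lambda>\<pi>. swap_adj (swap_pos \<pi>) \<pi>"])
    fix \<pi> assume "\<pi> \<in> {\<pi> \<in> ?A. \<pi> ! 0 \<noteq> Suc n}"
    then have \<pi>: "\<pi> \<in> ?A" "\<pi> ! 0 \<noteq> Max (set \<pi>)" using max[of \<pi>] by simp_all
    \<comment> \<open>A swap in positions 1 and 2 needs three entries, which the induction bound
      \<open>2 \<le> n\<close> provides.\<close>
    have len: "3 \<le> length \<pi>" using avoidersD(3)[OF \<pi>(1)] Suc.hyps by simp
    have "swap_pos \<pi> \<le> 1" by (simp add: swap_pos_def)
    with len have p: "Suc (swap_pos \<pi>) < length \<pi>" by linarith
    have "distinct \<pi>" "zigzag_below \<pi>" using \<pi>(1) unfolding avoiders by simp_all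
    note * = swap_adj_swap_pos[OF this len \<pi>(2)]
    have "swap_adj (swap_pos \<pi>) \<pi> \<in> ?A" using *(1) \<pi>(1) p unfolding avoiders by simp
    then show "swap_adj (swap_pos \<pi>) \<pi> \<in> {\<pi> \<in> ?A. \<pi> ! 0 \<noteq> Suc n}"
      using *(3) max[OF \<pi>(1)] by simp
    show "swap_adj (swap_pos (swap_adj (swap_pos \<pi>) \<pi>)) (swap_adj (swap_pos \<pi>) \<pi>) = \<pi>"
      using *(2) p by simp
    show "even_perm (swap_adj (swap_pos \<pi>) \<pi>) \<longleftrightarrow> \<not> even_perm \<pi>"
      using p \<open>distinct \<pi>\<close> by (rule even_perm_swap_adj)
  qed
  ultimately have "sign_balanced ({\<pi> \<in> ?A. \<pi> ! 0 = Suc n} \<union> {\<pi> \<in> ?A. \<pi> ! 0 \<noteq> Suc n})"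
    by (intro sign_balanced_Un) auto
  moreover have "{\<pi> \<in> ?A. \<pi> ! 0 = Suc n} \<union> {\<pi> \<in> ?A. \<pi> ! 0 \<noteq> Suc n} = ?A" by blast
  ultimately show ?case by simp
qed

section \<open>The twelve pairs\<close>

theorem theorem1p3:
  fixes n :: nat
  assumes "n > 1"
  shows "sign_balanced (avoiders n {[1, 2, 3, 4], [3, 2, 1, 4]}) \<and>
         sign_balanced (avoiders n {[4, 3, 2, 1], [4, 1, 2, 3]}) \<and>
         sign_balanced (avoiders n {[4, 3, 2, 1], [2, 3, 4, 1]}) \<and>
         sign_balanced (avoiders n {[1, 2, 3, 4], [1, 4, 3, 2]}) \<and>
         sign_balanced (avoiders n {[1, 2, 4, 3], [2, 1, 4, 3]}) \<and>
         sign_balanced (avoiders n {[3, 4, 2, 1], [3, 4, 1, 2]}) \<and>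
         sign_balanced (avoiders n {[4, 3, 1, 2], [3, 4, 1, 2]}) \<and>
         sign_balanced (avoiders n {[2, 1, 3, 4], [2, 1, 4, 3]}) \<and>
         sign_balanced (avoiders n {[1, 4, 2, 3], [1, 4, 3, 2]}) \<and>
         sign_balanced (avoiders n {[3, 2, 4, 1], [2, 3, 4, 1]}) \<and>
         sign_balanced (avoiders n {[4, 1, 3, 2], [4, 1, 2, 3]}) \<and>
         sign_balanced (avoiders n {[2, 3, 1, 4], [3, 2, 1, 4]})"
proof -
  \<comment> \<open>For \<open>p = 0\<close> the bound \<open>s \<le> p\<close> leaves only
    \<open>s = 0\<close>.\<close>
  have first: "sign_balanced (avoiders n \<Sigma>)"
    if "\<And>\<sigma>. \<sigma> \<in> \<Sigma> \<Longrightarrow> distinct \<sigma>" "\<And>\<sigma>. \<sigma> \<in> \<Sigma> \<Longrightarrow> swap_adj 0 \<sigma> \<in> \<Sigma>" for \<Sigma>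
    using assms that by (intro sign_balanced_avoiders_swap[of 0]) auto
  \<comment> \<open>For \<open>p = n - 2\<close> the room required after \<open>p\<close> leaves
    only the last two entries of the pattern.\<close>
  have last: "sign_balanced (avoiders n \<Sigma>)"
    if \<Sigma>: "\<And>\<sigma>. \<sigma> \<in> \<Sigma> \<Longrightarrow> distinct \<sigma>" "\<And>\<sigma>. \<sigma> \<in> \<Sigma> \<Longrightarrow> swap_adj (length \<sigma> - 2) \<sigma> \<in> \<Sigma>" for \<Sigma>
  proof (rule sign_balanced_avoiders_swap[of "n - 2"])
    fix \<sigma> s assume "\<sigma> \<in> \<Sigma>" "Suc s < length \<sigma>" "length \<sigma> + (n - 2) \<le> n + s"
    moreover from this have "s = length \<sigma> - 2" using assms by linarith
    ultimately show "swap_adj s \<sigma> \<in> \<Sigma>" using \<Sigma>(2) by simp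
  qed (use assms \<Sigma>(1) in auto)
  have 1: "sign_balanced (avoiders n {[1, 2, 3, 4], [3, 2, 1, 4]})"
    using assms by (intro sign_balanced_avoiders_1234_3214) simp
  have 2: "sign_balanced (avoiders n {[4, 3, 2, 1], [4, 1, 2, 3]})"
    using sign_balanced_avoiders_rev[OF 1] by force
  have 3: "sign_balanced (avoiders n {[4, 3, 2, 1], [2, 3, 4, 1]})"
    \<comment> \<open>The map \<open>5 - x\<close> is the complement on the entries 1 to 4.\<close>
    using sign_balanced_avoiders_complement[OF 1, of 5] by force
  have 4: "sign_balanced (avoiders n {[1, 2, 3, 4], [1, 4, 3, 2]})"
    using sign_balanced_avoiders_rev[OF 3] by force
  \<comment> \<open>In each of the eight remaining pairs the two patterns are exchanged by swapping
    their first or their last two entries.\<close>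
  show ?thesis
    by (intro conjI 1 2 3 4)
      ((rule first; auto simp: swap_adj_def), (rule last; auto simp: swap_adj_def numeral_2_eq_2),
       (rule first; auto simp: swap_adj_def), (rule last; auto simp: swap_adj_def numeral_2_eq_2),
       (rule last; auto simp: swap_adj_def numeral_2_eq_2), (rule first; auto simp: swap_adj_def),
       (rule last; auto simp: swap_adj_def numeral_2_eq_2), (rule first; auto simp: swap_adj_def))
qed

end
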